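(* Consider the control system $\dot x=f(x,u)$ with $f:\mathbb{R}^n\times\mathbb{R}^m\to\mathbb{R}^n$ locally Lipschitz, and let $\mathcal{C}\subseteq\mathbb{R}^n$ be a set for which there exists a continuously differentiable $h:\mathbb{R}^n\to\mathbb{R}$ with $\mathcal{C}=\{x:h(x)\ge0\}$, $\partial\mathcal{C}=\{x:h(x)=0\}$, $\mathrm{Int}(\mathcal{C})=\{x:h(x)>0\}$, and $\mathbf{0}_n\in\mathrm{Int}(\mathcal{C})$. Suppose $\mathcal{C}\ne\mathbb{R}^n$ is unbounded. Then there does not exist a CLBF of $\mathbb{R}^n\setminus\mathcal{C}$.
   Context: A function $\bar V:\mathbb{R}^n\to\mathbb{R}$ is proper if $\{x\in\mathbb{R}^n:\bar V(x)\le c\}$ is compact for every $c\ge0$. A proper and lower-bounded continuously differentiable function $\bar V:\mathbb{R}^n\to\mathbb{R}$ is a control Lyapunov-barrier function (CLBF) of $\mathbb{R}^n\setminus\mathcal{C}$ for $\dot x=f(x,u)$ if: (1) $\bar V(x)>0$ for all $x\in\mathbb{R}^n\setminus\mathcal{C}$; (2) $\mathcal{U}:=\{x\in\mathbb{R}^n:\bar V(x)\le0\}\ne\emptyset$; (3) $\overline{\mathcal{C}\setminus\mathcal{U}}\cap\overline{\mathbb{R}^n\setminus\mathcal{C}}=\emptyset$, where the overline denotes closure; (4) $\inf_{u\in\mathbb{R}^m}\nabla\bar V(x)^Tf(x,u)<0$ for all $x\in\mathcal{C}\setminus\{0\}$.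
   Formalization: The dimension is assumed to satisfy n ≥ 2, because the claim fails for n = 1: with f(x,u) = u and C = [−1,∞), h(x) = x+1, the function x² − 1 is a CLBF. *)

theory Defs
  imports "HOL-Analysis.Analysis"
begin

definition gradient :: "('a::real_inner \<Rightarrow> real) \<Rightarrow> 'a \<Rightarrow> 'a" where
  "gradient F x = (THE g. GDERIV F x :> g)"

definition continuously_differentiable :: "('a::real_inner \<Rightarrow> real) \<Rightarrow> bool" where
  "continuously_differentiable F \<longleftrightarrow>
     (\<forall>x. F differentiable (at x)) \<and> continuous_on UNIV (gradient F)"

text \<open>The library's \<^const>\<open>local_lipschitz\<close> is Lipschitz in one of two arguments only,
  uniformly in the other; here the joint notion on the product space is meant.\<close>

definition locally_lipschitz :: "('a::metric_space \<Rightarrow> 'b::metric_space) \<Rightarrow> bool" where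
  "locally_lipschitz F \<longleftrightarrow> (\<forall>z. \<exists>e>0. \<exists>L. L-lipschitz_on (ball z e) F)"

definition proper_fun :: "('a::topological_space \<Rightarrow> real) \<Rightarrow> bool" where
  "proper_fun V \<longleftrightarrow> (\<forall>c\<ge>0. compact {x. V x \<le> c})"

text \<open>\<open>CLBF f C V\<close>: \<open>V\<close> is a control Lyapunov-barrier function of the complement of \<open>C\<close>
  for the control system with right-hand side \<open>f\<close>. The infimum over all inputs may be
  \<open>-\<infinity>\<close>, hence it is taken in the extended reals.\<close>

definition CLBF ::
  "((real^'n) \<times> (real^'m) \<Rightarrow> real^'n) \<Rightarrow> (real^'n) set \<Rightarrow> (real^'n \<Rightarrow> real) \<Rightarrow> bool" where
  "CLBF f C V \<longleftrightarrow>
     proper_fun V \<and> bdd_below (range V) \<and> continuously_differentiable V \<and>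
     (\<forall>x\<in>- C. V x > 0) \<and>
     {x. V x \<le> 0} \<noteq> {} \<and>
     closure (C - {x. V x \<le> 0}) \<inter> closure (- C) = {} \<and>
     (\<forall>x\<in>C - {0}. (INF u. ereal (gradient V x \<bullet> f (x, u))) < 0)"

lemma gradient_eqI: "GDERIV F x :> g \<Longrightarrow> gradient F x = g"
  unfolding gradient_def
proof (rule the_equality)
  fix g' assume "GDERIV F x :> g" "GDERIV F x :> g'"
  then have "(\<lambda>h. inner h g) = (\<lambda>h. inner h g')"
    unfolding gderiv_def by (rule has_derivative_unique)
  then have "inner (g' - g) g = inner (g' - g) g'" by (rule fun_cong)
  then have "inner (g' - g) (g' - g) = 0" by (simp add: inner_diff_right)
  then show "g' = g" by simp
qed

lemma differentiable_imp_gderiv_gradient: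
  fixes F :: "'a::euclidean_space \<Rightarrow> real"
  assumes "F differentiable (at x)"
  shows "GDERIV F x :> gradient F x"
proof -
  obtain D where D: "(F has_derivative D) (at x)"
    using assms unfolding differentiable_def by blast
  then interpret bounded_linear D by (rule has_derivative_bounded_linear)
  have "D = (\<lambda>h. inner h (\<Sum>b\<in>Basis. D b *\<^sub>R b))"
  proof
    fix h
    have "D h = D (\<Sum>b\<in>Basis. inner h b *\<^sub>R b)" by (simp add: euclidean_representation)
    also have "\<dots> = inner h (\<Sum>b\<in>Basis. D b *\<^sub>R b)"
      by (simp add: sum scaleR inner_sum_right mult.commute)
    finally show "D h = inner h (\<Sum>b\<in>Basis. D b *\<^sub>R b)" .
  qed
  with D have G: "GDERIV F x :> (\<Sum>b\<in>Basis. D b *\<^sub>R b)"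
    unfolding gderiv_def by simp
  show ?thesis unfolding gradient_eqI[OF G] by (rule G)
qed

text \<open>In dimension one the nonexistence claim fails: for \<open>f (x, u) = u\<close> and the half-line
  \<open>x \<ge> -1\<close>, the function \<open>x\<^sup>2 - 1\<close> is a CLBF. This is why the dimension is assumed
  to be at least two.\<close>

lemma CLBF_dimension_one:
  defines "f \<equiv> (snd :: (real^1) \<times> (real^1) \<Rightarrow> real^1)"
    and "h \<equiv> (\<lambda>x::real^1. x $ 1 + 1)"
    and "C \<equiv> {x::real^1. x $ 1 + 1 \<ge> 0}"
  shows "locally_lipschitz f" "continuously_differentiable h"
    "C = {x. h x \<ge> 0}" "frontier C = {x. h x = 0}" "interior C = {x. h x > 0}"
    "0 \<in> interior C" "C \<noteq> UNIV" "\<not> bounded C"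
    "CLBF f C (\<lambda>x. x \<bullet> x - 1)"
proof -
  have one: "(x::real^1) \<bullet> y = x $ 1 * y $ 1" for x y by (simp add: inner_vec_def)
  have comp: "(x::real^1) $ 1 = x \<bullet> axis 1 1" for x by (simp add: inner_axis)
  have gh: "GDERIV h x :> axis 1 1" for x
    unfolding gderiv_def h_def comp by (auto intro!: derivative_eq_intros)
  have gV: "GDERIV (\<lambda>x::real^1. x \<bullet> x - 1) x :> 2 *\<^sub>R x" for x
    unfolding gderiv_def by (auto intro!: derivative_eq_intros simp: inner_commute)
  have grV: "gradient (\<lambda>x::real^1. x \<bullet> x - 1) = (\<lambda>x. 2 *\<^sub>R x)"
    using gradient_eqI[OF gV] by blast
  have grh: "gradient h = (\<lambda>x. axis 1 1)" using gradient_eqI[OF gh] by blast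
  have "1-lipschitz_on A f" for A
    unfolding f_def lipschitz_on_def by (simp add: dist_snd_le)
  then show "locally_lipschitz f" unfolding locally_lipschitz_def by (meson zero_less_one)
  show "continuously_differentiable h"
    unfolding continuously_differentiable_def grh differentiable_def
    using gh unfolding gderiv_def by auto
  show Ch: "C = {x. h x \<ge> 0}" unfolding C_def h_def ..
  have ax: "axis 1 1 \<noteq> (0::real^1)" by simp
  have Ceq: "C = {x. axis 1 1 \<bullet> x \<ge> -1}" unfolding C_def by (auto simp: inner_axis')
  show int: "interior C = {x. h x > 0}"
    unfolding Ceq interior_halfspace_ge[OF ax] by (auto simp: h_def inner_axis')
  show "frontier C = {x. h x = 0}"
    unfolding Ceq by (subst frontier_halfspace_ge) (use ax in \<open>auto simp: h_def inner_axis'\<close>)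
  show "0 \<in> interior C" unfolding int h_def by simp
  have "- 2 *\<^sub>R axis 1 1 \<notin> C" unfolding C_def by simp
  then show "C \<noteq> UNIV" by blast
  show "\<not> bounded C"
  proof
    assume "bounded C"
    then obtain B where B: "\<And>x. x \<in> C \<Longrightarrow> norm x \<le> B" unfolding bounded_iff by blast
    have "(\<bar>B\<bar> + 1) *\<^sub>R axis 1 1 \<in> C" unfolding C_def by simp
    from B[OF this] show False by (simp add: norm_axis_1)
  qed
  have sq: "t * t > 1" if "t < -1 \<or> t > 1" for t :: real
  proof -
    have "1 < \<bar>t\<bar>" using that by auto
    then have "1 * 1 < \<bar>t\<bar> * \<bar>t\<bar>" by (intro mult_strict_mono) auto
    then show ?thesis by simp
  qed
  show "CLBF f C (\<lambda>x. x \<bullet> x - 1)"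
    unfolding CLBF_def
  proof (intro conjI ballI)
    show "proper_fun (\<lambda>x::real^1. x \<bullet> x - 1)"
      unfolding proper_fun_def
    proof (intro allI impI)
      fix c :: real assume "c \<ge> 0"
      have "{x::real^1. x \<bullet> x - 1 \<le> c} = cball 0 (sqrt (c + 1))"
        by (auto simp: norm_eq_sqrt_inner)
      then show "compact {x::real^1. x \<bullet> x - 1 \<le> c}" by simp
    qed
    show "bdd_below (range (\<lambda>x::real^1. x \<bullet> x - 1))"
      by (rule bdd_belowI[of _ "-1"]) auto
    show "continuously_differentiable (\<lambda>x::real^1. x \<bullet> x - 1)"
      unfolding continuously_differentiable_def grV differentiable_def
      using gV unfolding gderiv_def by (auto intro!: continuous_intros)
    show "0 < x \<bullet> x - 1" if "x \<in> - C" for x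
      using that sq[of "x $ 1"] unfolding C_def one by simp
    have "(0::real^1) \<in> {x. x \<bullet> x - 1 \<le> 0}" by simp
    then show "{x::real^1. x \<bullet> x - 1 \<le> 0} \<noteq> {}" by blast
    have "closure (C - {x. x \<bullet> x - 1 \<le> 0}) \<subseteq> {x. axis 1 1 \<bullet> x \<ge> 1}"
    proof (rule closure_minimal)
      have "x $ 1 \<ge> 1" if "x \<in> C" "x \<bullet> x > 1" for x
      proof (rule ccontr)
        assume "\<not> x $ 1 \<ge> 1"
        then have "\<bar>x $ 1\<bar> \<le> 1" using that(1) unfolding C_def by auto
        then have "\<bar>x $ 1\<bar> * \<bar>x $ 1\<bar> \<le> 1 * 1" by (intro mult_mono) auto
        then show False using that(2) unfolding one by simp
      qed
      then show "C - {x. x \<bullet> x - 1 \<le> 0} \<subseteq> {x. axis 1 1 \<bullet> x \<ge> 1}" by (auto simp: inner_axis')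
    qed (rule closed_halfspace_ge)
    moreover have "closure (- C) \<subseteq> {x. axis 1 1 \<bullet> x \<le> -1}"
      unfolding Ceq by (rule closure_minimal) (auto simp: closed_halfspace_le)
    ultimately show "closure (C - {x. x \<bullet> x - 1 \<le> 0}) \<inter> closure (- C) = {}" by force
    fix x assume x: "x \<in> C - {0}"
    have "(INF u. ereal (gradient (\<lambda>x. x \<bullet> x - 1) x \<bullet> f (x, u))) \<le>
        ereal (gradient (\<lambda>x. x \<bullet> x - 1) x \<bullet> f (x, - x))"
      by (rule INF_lower) simp
    also have "\<dots> < 0" unfolding grV f_def using x by simp
    finally show "(INF u. ereal (gradient (\<lambda>x. x \<bullet> x - 1) x \<bullet> f (x, u))) < 0" .
  qed
qed

end

theory Submission
  imports Defs
begin

text \<open>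
  The argument is a mountain pass upside down. Suppose that \<open>V\<close> is a CLBF and let
  \<open>U = {x. V x \<le> 0}\<close>, a compact subset of \<open>C\<close>. At a critical point of \<open>V\<close> the infimum in
  the decrease condition would be \<open>0\<close>, so \<open>0\<close> is the only critical point that \<open>U\<close> can
  contain; since \<open>V\<close> attains its minimum, and does so in \<open>U\<close>, the origin is the unique
  minimiser. As \<open>C\<close> is unbounded and not everything, there are points \<open>p \<notin> C\<close> and
  \<open>q \<in> C - U\<close>. They lie in the two parts \<open>- C\<close> and \<open>C - U\<close> of \<open>{x. 0 < V x}\<close>, whose
  closures are disjoint, so no connected subset of \<open>{x. 0 < V x}\<close> contains both.

  On the other hand, in dimension at least two a ball remains path connected when the origin
  is removed, so \<open>p\<close> and \<open>q\<close> can be joined above the level \<open>V 0\<close>. Every level in the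
  interval from \<open>V 0\<close> (exclusive) to \<open>0\<close> is regular, and joinability persists up to level
  \<open>0\<close> (\<open>mountain_pass\<close>): at the supremum \<open>s\<close> of the levels above which \<open>p\<close> and \<open>q\<close> can be
  joined, compactness yields a connected set joining them in \<open>{x. s \<le> V x}\<close>
  (\<open>connected_superlevel_limit\<close>), regularity of the level pushes it into
  \<open>{x. s < V x}\<close> (\<open>connected_superlevel_imp_path_component_strict\<close>), and compactness of the
  resulting path allows a slightly higher level (\<open>path_component_superlevel_raise\<close>). This is
  the desired contradiction.

  The gradient of \<open>V\<close> is merely continuous, so it need not generate a unique flow. The usual
  deformation along the gradient is therefore replaced by straight steps in a fixed direction
  near a regular point, which is all that is needed to compare components.
\<close>

section \<open>Superlevel sets near a regular point\<close>

lemma gderiv_imp_isCont: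
  assumes "GDERIV V x :> g"
  shows "isCont V x"
  using assms unfolding gderiv_def by (rule has_derivative_continuous)

lemma isCont_greater_on_ball:
  fixes F :: "'a::metric_space \<Rightarrow> real"
  assumes "isCont F x" "c < F x"
  obtains d where "0 < d" "\<And>z. dist z x < d \<Longrightarrow> c < F z"
proof -
  have "\<forall>\<^sub>F z in at x. c < F z"
    using assms unfolding isCont_def by (rule order_tendstoD(1))
  then obtain d where "0 < d" "\<forall>z. z \<noteq> x \<and> dist z x < d \<longrightarrow> c < F z"
    unfolding eventually_at by auto
  then show thesis using assms(2) that[of d] by metis
qed

lemma gderiv_increasing_on_segment:
  fixes V :: "'a::real_inner \<Rightarrow> real"
  assumes grad: "\<And>y. GDERIV V y :> G y"
    and pos: "\<And>s. 0 \<le> s \<Longrightarrow> s \<le> t \<Longrightarrow> 0 < G (y + s *\<^sub>R v) \<bullet> v"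
    and t: "0 < t"
  shows "V y < V (y + t *\<^sub>R v)"
proof -
  have d: "((\<lambda>s. V (y + s *\<^sub>R v)) has_real_derivative (G (y + s *\<^sub>R v) \<bullet> v)) (at s)" for s
  proof -
    have "(V has_derivative (\<lambda>h. h \<bullet> G (y + s *\<^sub>R v))) (at (y + s *\<^sub>R v))"
      using grad unfolding gderiv_def .
    moreover have "((\<lambda>s. y + s *\<^sub>R v) has_derivative (\<lambda>h. h *\<^sub>R v)) (at s)"
      by (auto intro!: derivative_eq_intros)
    ultimately have "((\<lambda>s. V (y + s *\<^sub>R v)) has_derivative (\<lambda>h. (h *\<^sub>R v) \<bullet> G (y + s *\<^sub>R v))) (at s)"
      by (rule has_derivative_compose[rotated])
    moreover have "(\<lambda>h. (h *\<^sub>R v) \<bullet> G (y + s *\<^sub>R v)) = (*) (G (y + s *\<^sub>R v) \<bullet> v)"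
      by (simp add: fun_eq_iff inner_commute)
    ultimately show ?thesis
      unfolding has_field_derivative_def by simp
  qed
  have "V (y + 0 *\<^sub>R v) < V (y + t *\<^sub>R v)"
    by (rule DERIV_pos_imp_increasing[OF t, of "\<lambda>s. V (y + s *\<^sub>R v)"]) (use d pos in blast)
  then show ?thesis by simp
qed

text \<open>
  Near a regular point the fixed direction \<open>v = G x\<close> is an ascent direction. A step \<open>\<tau> v\<close>
  carries all points near \<open>x\<close> into one ball lying strictly above the level of \<open>x\<close>. This
  common ball is what ties together the parts of a superlevel set that approach \<open>x\<close>.
\<close>

lemma ascent_into_common_ball:
  fixes V :: "'a::real_inner \<Rightarrow> real"
  assumes grad: "\<And>y. GDERIV V y :> G y"
    and cont: "isCont G x"
    and nz: "G x \<noteq> 0"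
    and S: "open S" "x \<in> S"
  obtains \<delta> \<tau> v where "0 < \<delta>" "0 < \<tau>"
    "ball (x + \<tau> *\<^sub>R v) \<delta> \<subseteq> {z \<in> S. V x < V z}"
    "\<And>y t. y \<in> ball x \<delta> \<Longrightarrow> 0 < t \<Longrightarrow> t \<le> \<tau> \<Longrightarrow> y + t *\<^sub>R v \<in> S \<and> V y < V (y + t *\<^sub>R v)"
proof -
  define v where "v = G x"
  have v: "0 < norm v" using nz by (simp add: v_def)
  have "isCont (\<lambda>z. G z \<bullet> v) x" by (intro continuous_intros cont)
  moreover have "0 < G x \<bullet> v" using nz by (simp add: v_def)
  ultimately obtain r1 where r1: "0 < r1" "\<And>z. dist z x < r1 \<Longrightarrow> 0 < G z \<bullet> v"
    by (rule isCont_greater_on_ball) blast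
  obtain r2 where r2: "0 < r2" "ball x r2 \<subseteq> S"
    using S open_contains_ball by blast
  define r where "r = min r1 r2"
  have r: "0 < r" "\<And>z. dist z x < r \<Longrightarrow> 0 < G z \<bullet> v \<and> z \<in> S"
    using r1 r2 by (auto simp: r_def dist_commute)
  \<comment> \<open>From a starting point within \<open>r / 2\<close> of \<open>x\<close>, steps up to \<open>\<tau>\<close> stay within \<open>r\<close>.\<close>
  define \<tau> where "\<tau> = r / 2 / norm v"
  have \<tau>: "0 < \<tau>" "\<tau> * norm v = r / 2" using r v by (simp_all add: \<tau>_def)
  have near: "dist (y + t *\<^sub>R v) x < r" if "dist y x < r / 2" "0 \<le> t" "t \<le> \<tau>" for y t
  proof -
    have "dist (y + t *\<^sub>R v) x \<le> dist y x + t * norm v"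
      using norm_triangle_ineq[of "y - x" "t *\<^sub>R v"] that(2)
      by (simp add: dist_norm algebra_simps)
    also have "t * norm v \<le> r / 2"
      unfolding \<tau>(2)[symmetric] using that v by (intro mult_right_mono) auto
    finally show ?thesis using that by simp
  qed
  have up: "y + t *\<^sub>R v \<in> S \<and> V y < V (y + t *\<^sub>R v)"
    if "dist y x < r / 2" "0 < t" "t \<le> \<tau>" for y t
    using gderiv_increasing_on_segment[OF grad, of t y v] r(2) near[OF that(1)] that by auto
  have top: "x + \<tau> *\<^sub>R v \<in> S" "V x < V (x + \<tau> *\<^sub>R v)"
    using up[of x \<tau>] r(1) \<tau>(1) by auto
  have "isCont V (x + \<tau> *\<^sub>R v)" by (rule gderiv_imp_isCont[OF grad])
  then obtain d1 where d1: "0 < d1" "\<And>z. dist z (x + \<tau> *\<^sub>R v) < d1 \<Longrightarrow> V x < V z"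
    using top(2) by (rule isCont_greater_on_ball) blast
  obtain d2 where d2: "0 < d2" "ball (x + \<tau> *\<^sub>R v) d2 \<subseteq> S"
    using S(1) top(1) open_contains_ball by blast
  define d where "d = min d1 d2"
  have d: "0 < d" "\<And>z. dist z (x + \<tau> *\<^sub>R v) < d \<Longrightarrow> z \<in> S \<and> V x < V z"
    using d1 d2 by (auto simp: d_def dist_commute)
  show thesis
  proof (rule that[of "min d (r / 2)" \<tau> v])
    show "ball (x + \<tau> *\<^sub>R v) (min d (r / 2)) \<subseteq> {z \<in> S. V x < V z}"
      using d(2) by (auto simp: dist_commute)
  qed (use up r d \<tau> in \<open>auto simp: dist_commute\<close>)
qed

text \<open>
  Locally only one component of a strict superlevel set can be adherent to \<open>x\<close>. Above the
  level this is convexity of a small ball within \<open>X\<close>; on the level, every nearby point of the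
  superlevel set is the origin of a ray that rises into the common ball above \<open>x\<close>. Points
  on the level itself are only limits of such rays, whence the closure in the conclusion.
  At a critical point the claim can fail, as at a saddle, where two components touch.
\<close>

lemma closure_path_component_locally_fills:
  fixes V :: "'a::real_inner \<Rightarrow> real"
  assumes grad: "\<And>y. GDERIV V y :> G y"
    and cont: "isCont G x"
    and X: "convex X" "x \<in> X"
    and level: "c \<le> V x"
    and regular: "V x = c \<Longrightarrow> x \<in> interior X \<and> G x \<noteq> 0"
    and x: "x \<in> closure (path_component_set {z \<in> X. c < V z} p)"
  shows "\<exists>\<delta>>0. ball x \<delta> \<inter> {z \<in> X. c \<le> V z} \<subseteq> closure (path_component_set {z \<in> X. c < V z} p)"
proof -
  let ?Y = "{z \<in> X. c < V z}"
  let ?P = "path_component_set ?Y p"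
  have PY: "?P \<subseteq> ?Y" by (rule path_component_subset)
  have absorb: "T \<subseteq> ?P" if "path_connected T" "T \<subseteq> ?Y" "y \<in> T" "y \<in> ?P" for T y
    using path_component_maximal[OF that(3,1,2)] that(4) path_component_trans by blast
  show ?thesis
  proof (cases "V x = c")
    case False
    then have "c < V x" using level by simp
    then obtain d where d: "0 < d" "\<And>z. dist z x < d \<Longrightarrow> c < V z"
      using isCont_greater_on_ball[OF gderiv_imp_isCont[OF grad]] by blast
    obtain y where y: "y \<in> ?P" "dist y x < d"
      using x d(1) unfolding closure_approachable by blast
    have "ball x d \<inter> X \<subseteq> ?P"
    proof (rule absorb)
      show "path_connected (ball x d \<inter> X)"
        by (intro convex_imp_path_connected convex_Int X(1)) simp
      show "ball x d \<inter> X \<subseteq> ?Y" using d(2) by (auto simp: dist_commute)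
      show "y \<in> ball x d \<inter> X" using y PY by (auto simp: dist_commute)
    qed (rule y(1))
    then show ?thesis using d(1) closure_subset[of ?P] by blast
  next
    case True
    with regular have reg: "x \<in> interior X" "G x \<noteq> 0" by auto
    obtain \<delta> \<tau> v where \<delta>: "0 < \<delta>" and \<tau>: "0 < \<tau>"
      and top: "ball (x + \<tau> *\<^sub>R v) \<delta> \<subseteq> {z \<in> interior X. V x < V z}"
      and up: "\<And>y t. y \<in> ball x \<delta> \<Longrightarrow> 0 < t \<Longrightarrow> t \<le> \<tau> \<Longrightarrow>
                 y + t *\<^sub>R v \<in> interior X \<and> V y < V (y + t *\<^sub>R v)"
      using ascent_into_common_ball[OF grad cont reg(2) open_interior reg(1)] by blast
    have inX: "interior X \<subseteq> X" by (rule interior_subset)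
    let ?W = "ball (x + \<tau> *\<^sub>R v) \<delta>"
    have endW: "y + \<tau> *\<^sub>R v \<in> ?W" if "y \<in> ball x \<delta>" for y
      using that by (simp add: dist_norm)
    have ray: "(\<lambda>t. y + t *\<^sub>R v) ` T \<subseteq> ?Y" if "y \<in> ball x \<delta>" "c \<le> V y" "T \<subseteq> {0<..\<tau>}" for y T
    proof (rule image_subsetI)
      fix t assume "t \<in> T"
      then have "0 < t" "t \<le> \<tau>" using that(3) by auto
      then show "y + t *\<^sub>R v \<in> ?Y" using up[OF that(1), of t] that(2) inX by auto
    qed
    have pc: "path_connected ((\<lambda>t. y + t *\<^sub>R v) ` T)" if "convex T" for y and T :: "real set"
      by (intro path_connected_continuous_image continuous_intros convex_imp_path_connected that)
    obtain y where y: "y \<in> ?P" "dist y x < \<delta>"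
      using x \<delta> unfolding closure_approachable by blast
    have yb: "y \<in> ball x \<delta>" using y(2) by (simp add: dist_commute)
    have yc: "y \<in> X" "c < V y" using y(1) PY by auto
    \<comment> \<open>A point of the component near \<open>x\<close> pulls the common ball into the component, and the
      ball then pulls in all other rays.\<close>
    have "(\<lambda>t. y + t *\<^sub>R v) ` {0..\<tau>} \<subseteq> ?P"
    proof (rule absorb)
      have "{0..\<tau>} = insert 0 {0<..\<tau>}" using \<tau> by auto
      then show "(\<lambda>t. y + t *\<^sub>R v) ` {0..\<tau>} \<subseteq> ?Y"
        using ray[OF yb, of "{0<..\<tau>}"] yc by auto
      show "y \<in> (\<lambda>t. y + t *\<^sub>R v) ` {0..\<tau>}" by (rule image_eqI[of _ _ 0]) (use \<tau> in auto)
    qed (use pc y in auto)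
    then have "y + \<tau> *\<^sub>R v \<in> ?P"
      by (rule subsetD) (use \<tau> in \<open>auto intro: image_eqI[of _ _ \<tau>]\<close>)
    moreover have "?W \<subseteq> ?Y" using top inX True by auto
    ultimately have W: "?W \<subseteq> ?P"
      by (intro absorb[OF _ _ endW[OF yb]] convex_imp_path_connected) auto
    have "z \<in> closure ?P" if z: "z \<in> ball x \<delta>" "c \<le> V z" for z
    proof -
      have "(\<lambda>t. z + t *\<^sub>R v) ` {0<..\<tau>} \<subseteq> ?P"
      proof (rule absorb)
        show "z + \<tau> *\<^sub>R v \<in> ?P" using endW[OF z(1)] W by (rule subsetD[rotated])
        show "(\<lambda>t. z + t *\<^sub>R v) ` {0<..\<tau>} \<subseteq> ?Y" by (rule ray[OF z order_refl])
        show "path_connected ((\<lambda>t. z + t *\<^sub>R v) ` {0<..\<tau>})" by (rule pc) simp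
        show "z + \<tau> *\<^sub>R v \<in> (\<lambda>t. z + t *\<^sub>R v) ` {0<..\<tau>}"
          by (rule image_eqI[of _ _ \<tau>]) (use \<tau> in auto)
      qed
      then have "closure ((\<lambda>t. z + t *\<^sub>R v) ` {0<..\<tau>}) \<subseteq> closure ?P" by (rule closure_mono)
      moreover have "(\<lambda>t. z + t *\<^sub>R v) ` closure {0<..\<tau>} \<subseteq> closure ((\<lambda>t. z + t *\<^sub>R v) ` {0<..\<tau>})"
        by (intro image_closure_subset continuous_intros closure_subset) auto
      moreover have "z \<in> (\<lambda>t. z + t *\<^sub>R v) ` closure {0<..\<tau>}"
        using \<tau> by (intro image_eqI[of _ _ 0]) auto
      ultimately show ?thesis by blast
    qed
    then show ?thesis using \<delta> by blast
  qed
qed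

section \<open>Joining two points above a level\<close>

text \<open>
  By the local description, the closure of the component of \<open>p\<close> is relatively open in \<open>L\<close>,
  so it contains \<open>L\<close> and in particular \<open>q\<close>; and \<open>q\<close> lies strictly above the level, where
  being adherent to a component means belonging to it.
\<close>

lemma connected_superlevel_imp_path_component_strict:
  fixes V :: "'a::real_inner \<Rightarrow> real"
  assumes grad: "\<And>y. GDERIV V y :> G y"
    and cont: "continuous_on UNIV G"
    and X: "convex X"
    and regular: "\<And>x. x \<in> X \<Longrightarrow> V x = c \<Longrightarrow> x \<in> interior X \<and> G x \<noteq> 0"
    and L: "connected L" "L \<subseteq> {z \<in> X. c \<le> V z}" "p \<in> L" "q \<in> L"
    and p: "c < V p" and q: "c < V q"
  shows "path_component {z \<in> X. c < V z} p q"
proof -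
  let ?Y = "{z \<in> X. c < V z}"
  let ?P = "path_component_set ?Y p"
  have pP: "p \<in> ?P" using p L by (auto intro: path_component_refl)
  have fill: "\<exists>\<delta>>0. ball x \<delta> \<inter> {z \<in> X. c \<le> V z} \<subseteq> closure ?P"
    if "x \<in> L" "x \<in> closure ?P" for x
    using that L(2) regular cont
    by (intro closure_path_component_locally_fills[OF grad])
      (auto simp: continuous_on_eq_continuous_at X)
  have "openin (top_of_set L) (L \<inter> closure ?P)"
    unfolding openin_contains_ball
  proof (intro conjI ballI)
    fix x assume "x \<in> L \<inter> closure ?P"
    then obtain \<delta> where "0 < \<delta>" "ball x \<delta> \<inter> {z \<in> X. c \<le> V z} \<subseteq> closure ?P"
      using fill by blast
    then show "\<exists>\<epsilon>>0. ball x \<epsilon> \<inter> L \<subseteq> L \<inter> closure ?P"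
      using L(2) by blast
  qed simp
  moreover have "closedin (top_of_set L) (L \<inter> closure ?P)"
    by (simp add: closedin_closed_Int)
  ultimately have "L \<inter> closure ?P = L"
    using L(1) pP L(3) closure_subset[of ?P] unfolding connected_clopen by blast
  then have qcl: "q \<in> closure ?P" using L(4) by blast
  obtain d where d: "0 < d" "\<And>z. dist z q < d \<Longrightarrow> c < V z"
    using isCont_greater_on_ball[OF gderiv_imp_isCont[OF grad] q] by blast
  obtain y where y: "y \<in> ?P" "dist y q < d"
    using qcl d(1) unfolding closure_approachable by blast
  have "ball q d \<inter> X \<subseteq> path_component_set ?Y y"
  proof (rule path_component_maximal)
    show "y \<in> ball q d \<inter> X" using y path_component_subset[of ?Y p] by (auto simp: dist_commute)
    show "path_connected (ball q d \<inter> X)"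
      by (intro convex_imp_path_connected convex_Int X) simp
    show "ball q d \<inter> X \<subseteq> ?Y" using d(2) by (auto simp: dist_commute)
  qed
  moreover have "q \<in> ball q d \<inter> X" using L d(1) by auto
  ultimately have "path_component ?Y y q" by blast
  then show ?thesis using y(1) path_component_trans by blast
qed

text \<open>
  A limit of paths need not be a path, but a decreasing intersection of compact connected
  sets is connected. This is why closed superlevel sets are treated with connected sets, and
  strict ones with paths.
\<close>

lemma connected_superlevel_limit:
  fixes V :: "'a::euclidean_space \<Rightarrow> real"
  assumes V: "continuous_on UNIV V"
    and X: "compact X"
    and below: "\<And>c. c < s \<Longrightarrow> connected_component {z \<in> X. c \<le> V z} p q"
  obtains L where "connected L" "L \<subseteq> {z \<in> X. s \<le> V z}" "p \<in> L" "q \<in> L"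
proof -
  define l where "l n = s - inverse (real (Suc n))" for n
  define K where "K n = connected_component_set {z \<in> X. l n \<le> V z} p" for n
  have l: "l n < s" for n by (simp add: l_def)
  have lmono: "l m \<le> l n" if "m \<le> n" for m n
    using that by (auto simp: l_def intro!: le_imp_inverse_le)
  have cl: "compact {z \<in> X. a \<le> V z}" for a
  proof -
    have "closed (V -` {a..})" using V by (intro continuous_closed_vimage)
      (auto simp: continuous_on_eq_continuous_at)
    then have "compact (X \<inter> V -` {a..})" using X by (rule compact_Int_closed[rotated])
    moreover have "X \<inter> V -` {a..} = {z \<in> X. a \<le> V z}" by auto
    ultimately show ?thesis by simp
  qed
  have sub: "K n \<subseteq> {z \<in> X. l n \<le> V z}" for n
    unfolding K_def by (rule connected_component_subset)
  have "connected (\<Inter> (range K))"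
  proof (rule connected_nest)
    show "compact (K n)" for n
      unfolding K_def compact_eq_bounded_closed
      using cl[of "l n"] connected_component_subset[of "{z \<in> X. l n \<le> V z}" p]
      by (metis bounded_subset closed_connected_component compact_eq_bounded_closed)
    show "connected (K n)" for n unfolding K_def by simp
    show "K n \<subseteq> K m" if "m \<le> n" for m n
      unfolding K_def using lmono[OF that] by (intro connected_component_mono) auto
  qed
  moreover have "\<Inter> (range K) \<subseteq> {z \<in> X. s \<le> V z}"
  proof
    fix z assume z: "z \<in> \<Inter> (range K)"
    then have "z \<in> X" and ln: "\<And>n. l n \<le> V z" using sub by blast+
    have "l \<longlonglongrightarrow> s - 0" unfolding l_def
      by (intro tendsto_diff tendsto_const LIMSEQ_inverse_real_of_nat)
    then have "s \<le> V z" by (intro LIMSEQ_le_const2[of l]) (use ln in auto)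
    with \<open>z \<in> X\<close> show "z \<in> {z \<in> X. s \<le> V z}" by simp
  qed
  moreover have "q \<in> \<Inter> (range K)" using below[OF l] by (auto simp: K_def)
  moreover have "p \<in> \<Inter> (range K)"
    using below[OF l] connected_component_refl connected_component_in by (fastforce simp: K_def)
  ultimately show thesis using that by blast
qed

lemma path_component_superlevel_raise:
  fixes V :: "'a::topological_space \<Rightarrow> real"
  assumes V: "continuous_on UNIV V"
    and pc: "path_component {z \<in> X. c < V z} p q"
  obtains c' where "c < c'" "path_component {z \<in> X. c' < V z} p q"
proof -
  obtain g where g: "path g" "path_image g \<subseteq> {z \<in> X. c < V z}" "pathstart g = p" "pathfinish g = q"
    using pc unfolding path_component_def by blast
  have "continuous_on (path_image g) V" using V by (rule continuous_on_subset) simp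
  then obtain w where w: "w \<in> path_image g" "\<And>z. z \<in> path_image g \<Longrightarrow> V w \<le> V z"
    using continuous_attains_inf[OF compact_path_image[OF g(1)] path_image_nonempty] by blast
  have cw: "c < V w" using w(1) g(2) by auto
  show thesis
  proof (rule that[of "(c + V w) / 2"])
    have "path_image g \<subseteq> {z \<in> X. (c + V w) / 2 < V z}"
      using g(2) w(2) cw by (force simp: field_simps)
    then show "path_component {z \<in> X. (c + V w) / 2 < V z} p q"
      using g unfolding path_component_def by blast
  qed (use cw in simp)
qed

text \<open>
  The set of levels above which \<open>p\<close> and \<open>q\<close> can be joined contains its supremum and, below
  \<open>b\<close>, a higher level with each of its members. The lowest level \<open>a\<close> is allowed to be
  critical, since there joinability is the hypothesis. That the levels considered avoid the boundary of
  \<open>X\<close> makes the ascent steps stay in \<open>X\<close>.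
\<close>

lemma mountain_pass:
  fixes V :: "'a::euclidean_space \<Rightarrow> real"
  assumes grad: "\<And>y. GDERIV V y :> G y"
    and cont: "continuous_on UNIV G"
    and X: "compact X" "convex X"
    and regular: "\<And>x. x \<in> X \<Longrightarrow> a < V x \<Longrightarrow> V x \<le> b \<Longrightarrow> x \<in> interior X \<and> G x \<noteq> 0"
    and p: "b < V p" and q: "b < V q"
    and ab: "a \<le> b"
    and start: "path_component {z \<in> X. a < V z} p q"
  shows "path_component {z \<in> X. b < V z} p q"
proof -
  define T where "T = {c \<in> {a..b}. path_component {z \<in> X. c < V z} p q}"
  define s where "s = Sup T"
  have V: "continuous_on UNIV V"
    using gderiv_imp_isCont[OF grad] by (simp add: continuous_on_eq_continuous_at)
  have aT: "a \<in> T" using ab start by (simp add: T_def)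
  have bdd: "bdd_above T" by (rule bdd_aboveI[of _ b]) (simp add: T_def)
  have as: "a \<le> s" unfolding s_def using aT bdd by (rule cSup_upper)
  have sb: "s \<le> b" unfolding s_def by (rule cSup_least) (use aT in \<open>auto simp: T_def\<close>)
  have at_s: "path_component {z \<in> X. s < V z} p q"
  proof (cases "s = a")
    case True
    then show ?thesis using start by simp
  next
    case False
    have "connected_component {z \<in> X. c \<le> V z} p q" if cs: "c < s" for c
    proof -
      obtain c' where c': "c' \<in> T" "c < c'"
        using cs less_cSup_iff[of T c] aT bdd unfolding s_def by blast
      then have "path_component {z \<in> X. c' < V z} p q" by (simp add: T_def)
      then have "path_component {z \<in> X. c \<le> V z} p q"
        by (rule path_component_of_subset[rotated]) (use c' in auto)
      then show ?thesis using path_component_subset_connected_component by blast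
    qed
    then obtain L where L: "connected L" "L \<subseteq> {z \<in> X. s \<le> V z}" "p \<in> L" "q \<in> L"
      using connected_superlevel_limit[OF V X(1)] by metis
    show ?thesis
      by (rule connected_superlevel_imp_path_component_strict[OF grad cont X(2) _ L])
        (use regular False as sb p q in auto)
  qed
  have "s = b"
  proof (rule ccontr)
    assume "s \<noteq> b"
    then have "s < b" using sb by simp
    obtain c' where c': "s < c'" "path_component {z \<in> X. c' < V z} p q"
      using path_component_superlevel_raise[OF V at_s] .
    have "path_component {z \<in> X. min c' b < V z} p q"
      by (rule path_component_of_subset[OF _ c'(2)]) auto
    then have "min c' b \<in> T" using as \<open>s < b\<close> c'(1) by (auto simp: T_def)
    then have "min c' b \<le> s" unfolding s_def using bdd by (rule cSup_upper)
    then show False using c'(1) \<open>s < b\<close> by simp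
  qed
  then show ?thesis using at_s by simp
qed

section \<open>Nonexistence of a control Lyapunov-barrier function\<close>

lemma gradient_zero_at_minimum:
  fixes V :: "'a::real_inner \<Rightarrow> real"
  assumes "GDERIV V x :> g" and "\<And>y. V x \<le> V y"
  shows "g = 0"
proof -
  have "(\<lambda>h. h \<bullet> g) = (\<lambda>h. 0)"
    by (rule differential_zero_maxmin[of x UNIV V])
      (use assms in \<open>auto simp: gderiv_def\<close>)
  then have "g \<bullet> g = 0" by (rule fun_cong)
  then show ?thesis by simp
qed

theorem propositionV2:
  fixes f :: "(real^'n) \<times> (real^'m) \<Rightarrow> real^'n"
    and h :: "real^'n \<Rightarrow> real"
    and C :: "(real^'n) set"
  assumes "2 \<le> CARD('n)"
    and "locally_lipschitz f"
    and "continuously_differentiable h"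
    and "C = {x. h x \<ge> 0}"
    and "frontier C = {x. h x = 0}"
    and "interior C = {x. h x > 0}"
    and "0 \<in> interior C"
    and "C \<noteq> UNIV"
    and "\<not> bounded C"
  shows "\<not> (\<exists>V. CLBF f C V)"
proof
  assume "\<exists>V. CLBF f C V"
  then obtain V where "CLBF f C V" ..
  then have proper: "proper_fun V" and cd: "continuously_differentiable V"
    and outside: "\<And>x. x \<notin> C \<Longrightarrow> 0 < V x"
    and ne: "{x. V x \<le> 0} \<noteq> {}"
    and sep: "closure (C - {x. V x \<le> 0}) \<inter> closure (- C) = {}"
    and decrease: "\<And>x. x \<in> C - {0} \<Longrightarrow> (INF u. ereal (gradient V x \<bullet> f (x, u))) < 0"
    unfolding CLBF_def by auto
  let ?U = "{x. V x \<le> 0}"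
  have grad: "GDERIV V x :> gradient V x" for x
    using cd unfolding continuously_differentiable_def
    by (blast intro: differentiable_imp_gderiv_gradient)
  have cont: "continuous_on UNIV (gradient V)"
    using cd unfolding continuously_differentiable_def by blast
  have V: "continuous_on A V" for A
    using gderiv_imp_isCont[OF grad] by (simp add: continuous_at_imp_continuous_on)
  have regular: "gradient V x \<noteq> 0" if "V x \<le> 0" "x \<noteq> 0" for x
  proof
    assume "gradient V x = 0"
    moreover have "x \<in> C" using outside[of x] that(1) by force
    ultimately show False using decrease[of x] that(2) by (simp add: zero_ereal_def)
  qed
  have U: "compact ?U" using proper unfolding proper_fun_def by simp
  obtain x0 where x0: "V x0 \<le> 0" "\<And>y. V y \<le> 0 \<Longrightarrow> V x0 \<le> V y"
    using continuous_attains_inf[OF U ne V] by auto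
  have minimal: "x = 0" if "V x = V x0" for x
  proof (rule ccontr)
    assume "x \<noteq> 0"
    moreover have "V x \<le> V y" for y using x0 that by (cases "V y \<le> 0") auto
    then have "gradient V x = 0" by (rule gradient_zero_at_minimum[OF grad])
    ultimately show False using regular[of x] x0(1) that by simp
  qed
  have x0_0: "x0 = 0" by (rule minimal) simp
  have above: "V 0 < V y" if "y \<noteq> 0" for y
    using minimal[of y] x0 that unfolding x0_0 by (cases "V y \<le> 0") force+
  obtain p where p: "p \<notin> C" using assms(8) by blast
  have "\<not> C \<subseteq> ?U" using assms(9) compact_imp_bounded[OF U] bounded_subset by blast
  then obtain q where q: "q \<in> C" "0 < V q" by (auto simp: subset_iff not_le)
  \<comment> \<open>A ball with \<open>U\<close> in its interior, so that \<open>V\<close> is positive on its boundary sphere.\<close>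
  have "bounded (insert p (insert q ?U))" using compact_imp_bounded[OF U] by simp
  then obtain R where R: "0 < R" "insert p (insert q ?U) \<subseteq> ball 0 R"
    by (rule bounded_subset_ballD[THEN exE]) blast
  let ?X = "cball (0::real^'n) R"
  have inX: "?U \<subseteq> interior ?X" "p \<in> ?X" "q \<in> ?X" using R(2) by auto
  have "aff_dim ?X = int CARD('n)" using R(1) by (simp add: aff_dim_cball)
  then have "path_connected (?X - {0})"
    using assms(1) by (intro path_connected_punctured_convex) auto
  moreover have "p \<noteq> 0" "q \<noteq> 0"
    using outside[OF p] q(2) x0(1) unfolding x0_0 by force+
  ultimately have "path_component (?X - {0}) p q"
    using inX by (auto simp: path_connected_component)
  then have start: "path_component {z \<in> ?X. V 0 < V z} p q"
    by (rule path_component_of_subset[rotated]) (use above in auto)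
  have "path_component {z \<in> ?X. 0 < V z} p q"
  proof (rule mountain_pass[OF grad cont _ _ _ _ _ _ start])
    show "x \<in> interior ?X \<and> gradient V x \<noteq> 0" if "V 0 < V x" "V x \<le> 0" for x
      using regular[of x] inX(1) that by auto
  qed (use outside[OF p] q(2) x0(1) x0_0 in auto)
  then have "connected_component {z \<in> ?X. 0 < V z} p q"
    using path_component_subset_connected_component by blast
  then obtain T where T: "connected T" "T \<subseteq> {z \<in> ?X. 0 < V z}" "p \<in> T" "q \<in> T"
    unfolding connected_component_def by blast
  let ?A = "closure (C - ?U)" and ?B = "closure (- C)"
  have "T \<subseteq> ?A \<union> ?B"
    using T(2) closure_subset[of "C - ?U"] closure_subset[of "- C"] by force
  moreover have "?A \<inter> T \<noteq> {}" "?B \<inter> T \<noteq> {}"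
    using T(3,4) p q closure_subset[of "C - ?U"] closure_subset[of "- C"] by force+
  moreover have "?A \<inter> ?B \<inter> T = {}" using sep by simp
  ultimately show False
    using connected_closedD[OF T(1), of ?A ?B] by simp
qed

end
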